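(* Every right-angled Coxeter group (that is, every Coxeter group with $m(i,i')\in\{2,\infty\}$ for all distinct $i,i'\in I$) is superfuturistic.
   Context: Let $(W,S)$ be a Coxeter system with $S=\{s_i:i\in I\}$, $I$ a finite index set; $m(i,i')$ is the order of $s_is_{i'}$. The root space is $V=\mathbb R^I$ with standard basis the simple roots $\{\alpha_i:i\in I\}$ and symmetric bilinear form $B(\alpha_i,\alpha_{i'})=-\cos(\pi/m(i,i'))$ (and $-1$ if $m(i,i')=\infty$). $W$ acts on $V$ by $s_i\beta=\beta-2B(\beta,\alpha_i)\alpha_i$. The root system is $\Phi=\{w\alpha_i:w\in W,i\in I\}=\Phi^+\sqcup\Phi^-$, where $\Phi^+$ are the roots that are nonnegative combinations of simple roots and $\Phi^-=-\Phi^+$. For $\beta\in\Phi$ the half-space $H_\beta^+$ is $\{w\in W:w\beta\in\Phi^+\}$. A subset of $W$ is convex if it is an intersection of half-spaces (the empty intersection being $W$). For a nonempty convex set $\mathscr L\subseteq W$ let $\mathrm R(\mathscr L)=\{\beta\in\Phi:\mathscr L\subseteq H_\beta^+\}$. For $i\in I$, the toggle $\tau_i\colon W\to W$ is defined by $\tau_i(u)=u$ if $u^{-1}\alpha_i\in\mathrm R(\mathscr L)$ and $\tau_i(u)=s_iu$ otherwise. A Coxeter element is a product $c=s_{i_n}\cdots s_{i_1}$ where $i_1,\ldots,i_n$ is an ordering of $I$ (each element once); $\mathrm{Pro}_c=\tau_{i_n}\cdots\tau_{i_1}$ (composition), which depends only on $c$ and $\mathscr L$. The set $\mathscr L$ is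 superheavy with respect to $c$ if for every $u\in W$ there is an integer $K\ge 0$ with $\mathrm{Pro}_c^K(u)\in\mathscr L$. The Coxeter group $W$ is superfuturistic if every nonempty convex subset of $W$ is superheavy with respect to every Coxeter element of $W$. *)

theory Defs
  imports Complex_Main "HOL-Algebra.Algebra"
begin

(* One application of a defining relation (s_i s_j)^m(i,j) = 1 inside a word.
   An infinite m(i,j) is encoded by 0, for which the relation is empty. *)
inductive coxeter_step :: "'i set \<Rightarrow> ('i \<Rightarrow> 'i \<Rightarrow> nat) \<Rightarrow> 'i list \<Rightarrow> 'i list \<Rightarrow> bool"
  for I m where
  "i \<in> I \<Longrightarrow> j \<in> I \<Longrightarrow>
     coxeter_step I m (us @ concat (replicate (m i j) [i, j]) @ vs) (us @ vs)"

(* The assumption "presentation" says that every relation among the s_i follows from the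
   relations (s_i s_j)^m(i,j) = 1, where m(i,j) is the order of s_i s_j (0 if infinite).
   The case i = j, with m(i,i) = 1, is s_i^2 = 1; therefore words in the s_i without inverses
   suffice and the monoid presentation is the group presentation. *)
locale coxeter_system = group W for W (structure) +
  fixes I :: "'i set" and s :: "'i \<Rightarrow> 'a"
  assumes finite_index: "finite I"
    and gen_closed: "i \<in> I \<Longrightarrow> s i \<in> carrier W"
    and gen_inj: "inj_on s I"
    and gen_ord: "i \<in> I \<Longrightarrow> ord (s i) = 2"
    and generates: "carrier W = generate W (s ` I)"
    and presentation: "ws \<in> lists I \<Longrightarrow> foldr (\<lambda>i w. s i \<otimes> w) ws \<one> = \<one> \<Longrightarrow>
          equivclp (coxeter_step I (\<lambda>i j. ord (s i \<otimes> s j))) ws []"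
begin

definition m :: "'i \<Rightarrow> 'i \<Rightarrow> nat" where
  "m i j = ord (s i \<otimes> s j)"

definition eval_word :: "'i list \<Rightarrow> 'a" where
  "eval_word ws = foldr (\<lambda>i w. s i \<otimes> w) ws \<one>"

(* The root space R^I is the set of functions vanishing outside I. *)
definition simple_root :: "'i \<Rightarrow> 'i \<Rightarrow> real" where
  "simple_root i = (\<lambda>j. if j = i then 1 else 0)"

definition form_coeff :: "'i \<Rightarrow> 'i \<Rightarrow> real" where
  "form_coeff i j = (if m i j = 0 then -1 else - cos (pi / real (m i j)))"

definition form :: "('i \<Rightarrow> real) \<Rightarrow> ('i \<Rightarrow> real) \<Rightarrow> real" where
  "form \<beta> \<gamma> = (\<Sum>i\<in>I. \<Sum>j\<in>I. \<beta> i * \<gamma> j * form_coeff i j)"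

definition reflect :: "'i \<Rightarrow> ('i \<Rightarrow> real) \<Rightarrow> 'i \<Rightarrow> real" where
  "reflect i \<beta> = (\<lambda>j. \<beta> j - 2 * form \<beta> (simple_root i) * simple_root i j)"

(* The element w = s_{i_1} ... s_{i_k} acts as the composite of the reflections i_1, ..., i_k
   (i_k first). On R^I this does not depend on the chosen word for w, because the reflections
   satisfy the defining relations of W. *)
definition act :: "'a \<Rightarrow> ('i \<Rightarrow> real) \<Rightarrow> 'i \<Rightarrow> real" where
  "act w = foldr reflect (SOME ws. ws \<in> lists I \<and> eval_word ws = w)"

definition roots :: "('i \<Rightarrow> real) set" where
  "roots = {act w (simple_root i) | w i. w \<in> carrier W \<and> i \<in> I}"

definition positive_roots :: "('i \<Rightarrow> real) set" where
  "positive_roots = {\<beta> \<in> roots. \<forall>i\<in>I. 0 \<le> \<beta> i}"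

definition half_space :: "('i \<Rightarrow> real) \<Rightarrow> 'a set" where
  "half_space \<beta> = {w \<in> carrier W. act w \<beta> \<in> positive_roots}"

definition convex_subset :: "'a set \<Rightarrow> bool" where
  "convex_subset L \<longleftrightarrow> (\<exists>A \<subseteq> roots. L = carrier W \<inter> (\<Inter>\<beta>\<in>A. half_space \<beta>))"

definition containing_roots :: "'a set \<Rightarrow> ('i \<Rightarrow> real) set" where
  "containing_roots L = {\<beta> \<in> roots. L \<subseteq> half_space \<beta>}"

definition toggle :: "'a set \<Rightarrow> 'i \<Rightarrow> 'a \<Rightarrow> 'a" where
  "toggle L i u =
     (if act (inv u) (simple_root i) \<in> containing_roots L then u else s i \<otimes> u)"

(* A list [i_1, ..., i_n]; the associated Coxeter element is s_{i_n} ... s_{i_1}, and the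
   associated promotion operator applies the toggle of i_1 first. *)
definition index_ordering :: "'i list \<Rightarrow> bool" where
  "index_ordering xs \<longleftrightarrow> distinct xs \<and> set xs = I"

definition coxeter_element :: "'a \<Rightarrow> bool" where
  "coxeter_element c \<longleftrightarrow> (\<exists>xs. index_ordering xs \<and> c = eval_word (rev xs))"

definition promotion :: "'a set \<Rightarrow> 'i list \<Rightarrow> 'a \<Rightarrow> 'a" where
  "promotion L xs = fold (toggle L) xs"

(* All orderings with product c give the same promotion operator Pro_c, so quantifying over
   all of them avoids choosing one. *)
definition superheavy :: "'a set \<Rightarrow> 'a \<Rightarrow> bool" where
  "superheavy L c \<longleftrightarrow>
     (\<forall>xs. index_ordering xs \<and> c = eval_word (rev xs) \<longrightarrow>
        (\<forall>u \<in> carrier W. \<exists>K. (promotion L xs ^^ K) u \<in> L))"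

definition superfuturistic :: bool where
  "superfuturistic \<longleftrightarrow>
     (\<forall>L c. convex_subset L \<and> L \<noteq> {} \<and> coxeter_element c \<longrightarrow> superheavy L c)"

definition right_angled :: bool where
  "right_angled \<longleftrightarrow> (\<forall>i\<in>I. \<forall>j\<in>I. i \<noteq> j \<longrightarrow> m i j = 2 \<or> m i j = 0)"

end

end

theory Submission
  imports Defs "HOL-Library.Function_Algebras"
begin

text \<open>Let \<open>K\<close> be the cone of vectors all of whose \<open>W\<close>-images have nonnegative coordinates. In the
  right-angled case \<open>\<alpha>\<^sub>i + \<alpha>\<^sub>j \<in> K\<close> whenever \<open>m i j = \<infinity>\<close>, and every positive root \<open>\<gamma>\<close> lies in
  \<open>\<alpha>\<^sub>i + K\<close> for some \<open>i\<close>. Applied to \<open>\<gamma> = - u \<beta>\<close>, the latter shows that if a root \<open>\<beta>\<close> of \<open>R(L)\<close>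
  separates \<open>u\<close> from \<open>L\<close>, then so does one with \<open>u \<beta> = - \<alpha>\<^sub>j\<close>. For such a \<open>\<beta>\<close>, a toggle at
  \<open>i \<noteq> j\<close> preserves \<open>u \<beta> = - \<alpha>\<^sub>j\<close>: either \<open>s\<^sub>i\<close> and \<open>s\<^sub>j\<close> commute, or \<open>\<alpha>\<^sub>i + \<alpha>\<^sub>j \<in> K\<close> forces
  \<open>u\<inverse> \<alpha>\<^sub>i \<in> R(L)\<close> and nothing moves. Hence the toggle at \<open>j\<close> crosses the wall of \<open>\<beta>\<close>. As toggles
  never leave a half-space containing \<open>L\<close>, each promotion strictly shrinks the finite set of roots
  of \<open>R(L)\<close> separating the current element from \<open>L\<close>.\<close>

locale right_angled_coxeter_system = coxeter_system W I s
  for W :: "('a, 'b) monoid_scheme" (structure) and I :: "'i set" and s :: "'i \<Rightarrow> 'a" +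
  assumes right_angled: right_angled
begin

abbreviation nonneg :: "('i \<Rightarrow> real) \<Rightarrow> bool" where
  "nonneg v \<equiv> \<forall>i\<in>I. 0 \<le> v i"

section \<open>Generators and words\<close>

lemma gen_square: "i \<in> I \<Longrightarrow> s i \<otimes> s i = \<one>"
  using pow_ord_eq_1[OF gen_closed, of i] gen_closed[of i] by (simp add: gen_ord numeral_2_eq_2)

lemma inv_gen: "i \<in> I \<Longrightarrow> inv (s i) = s i"
  by (simp add: gen_closed gen_square inv_equality)

lemma m_self: "i \<in> I \<Longrightarrow> m i i = 1"
  by (simp add: m_def gen_square)

lemma inv_gen_mult: "i \<in> I \<Longrightarrow> j \<in> I \<Longrightarrow> inv (s i \<otimes> s j) = s j \<otimes> s i"
  by (simp add: inv_mult_group gen_closed inv_gen)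

lemma m_sym:
  assumes "i \<in> I" "j \<in> I"
  shows "m i j = m j i"
  unfolding m_def inv_gen_mult[OF assms, symmetric] using assms by (simp add: gen_closed)

lemma m_cases:
  assumes "i \<in> I" "j \<in> I" "i \<noteq> j"
  obtains "m i j = 2" | "m i j = 0"
proof -
  have "m i j = 2 \<or> m i j = 0"
    using right_angled[unfolded right_angled_def, rule_format, OF assms] .
  then show ?thesis using that by (elim disjE)
qed

lemma gen_commute:
  assumes "i \<in> I" "j \<in> I" "m i j = 2"
  shows "s i \<otimes> s j = s j \<otimes> s i"
proof -
  have closed: "s i \<otimes> s j \<in> carrier W" using assms by (simp add: gen_closed)
  have "(s i \<otimes> s j) [^] (2::nat) = \<one>"
    using pow_eq_id[OF closed, of 2] assms(3) by (simp only: m_def dvd_refl)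
  then have "(s i \<otimes> s j) \<otimes> (s i \<otimes> s j) = \<one>"
    using closed by (simp only: numeral_2_eq_2 nat_pow_Suc nat_pow_0 l_one)
  then have "inv (s i \<otimes> s j) = s i \<otimes> s j"
    using closed by (intro inv_equality)
  then show ?thesis
    unfolding inv_gen_mult[OF assms(1,2)] by (rule sym)
qed

lemma eval_word_Nil [simp]: "eval_word [] = \<one>"
  by (simp add: eval_word_def)

lemma eval_word_Cons [simp]: "eval_word (i # ws) = s i \<otimes> eval_word ws"
  by (simp add: eval_word_def)

lemma eval_word_closed [simp]: "ws \<in> lists I \<Longrightarrow> eval_word ws \<in> carrier W"
  by (induction ws) (auto simp: gen_closed)

lemma eval_word_append:
  "us \<in> lists I \<Longrightarrow> vs \<in> lists I \<Longrightarrow> eval_word (us @ vs) = eval_word us \<otimes> eval_word vs"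
  by (induction us) (auto simp: gen_closed m_assoc)

lemma rev_in_lists [simp]: "rev ws \<in> lists I \<longleftrightarrow> ws \<in> lists I"
  by (simp add: in_lists_conv_set)

lemma eval_word_rev: "ws \<in> lists I \<Longrightarrow> eval_word (rev ws) = inv (eval_word ws)"
  by (induction ws) (simp_all add: eval_word_append gen_closed inv_gen inv_mult_group)

lemma ex_word:
  assumes "w \<in> carrier W"
  shows "\<exists>ws \<in> lists I. eval_word ws = w"
proof -
  have "w \<in> generate W (s ` I)"
    using assms generates by simp
  then show ?thesis
  proof (induction rule: generate.induct)
    case one
    show ?case by (intro bexI[of _ "[]"]) auto
  next
    case (incl h)
    then obtain i where "i \<in> I" "h = s i" by auto
    then show ?case by (intro bexI[of _ "[i]"]) (auto simp: gen_closed)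
  next
    case (inv h)
    then obtain i where "i \<in> I" "h = s i" by auto
    then show ?case by (intro bexI[of _ "[i]"]) (auto simp: gen_closed inv_gen)
  next
    case (eng h1 h2)
    then obtain us vs where "us \<in> lists I" "eval_word us = h1" "vs \<in> lists I" "eval_word vs = h2"
      by auto
    then show ?case by (intro bexI[of _ "us @ vs"]) (auto simp: eval_word_append)
  qed
qed

section \<open>The bilinear form and the simple reflections\<close>

lemma form_coeff_self: "i \<in> I \<Longrightarrow> form_coeff i i = 1"
  by (simp add: form_coeff_def m_self)

lemma form_coeff_2: "m i j = 2 \<Longrightarrow> form_coeff i j = 0"
  by (simp add: form_coeff_def)

lemma form_coeff_0: "m i j = 0 \<Longrightarrow> form_coeff i j = -1"
  by (simp add: form_coeff_def)

lemma form_simple_root: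
  assumes "i \<in> I"
  shows "form \<beta> (simple_root i) = (\<Sum>j\<in>I. \<beta> j * form_coeff j i)"
  unfolding form_def
proof (rule sum.cong)
  fix k
  have "(\<Sum>j\<in>I. \<beta> k * simple_root i j * form_coeff k j)
      = (\<Sum>j\<in>I. if j = i then \<beta> k * form_coeff k j else 0)"
    by (intro sum.cong) (auto simp: simple_root_def)
  then show "(\<Sum>j\<in>I. \<beta> k * simple_root i j * form_coeff k j) = \<beta> k * form_coeff k i"
    using assms finite_index by simp
qed simp

lemma form_simple_simple:
  assumes "i \<in> I" "j \<in> I"
  shows "form (simple_root j) (simple_root i) = form_coeff j i"
proof -
  have "form (simple_root j) (simple_root i) = (\<Sum>k\<in>I. if k = j then form_coeff k i else 0)"
    unfolding form_simple_root[OF assms(1)] by (intro sum.cong) (auto simp: simple_root_def)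
  then show ?thesis
    using assms finite_index by simp
qed

lemma form_add: "form (\<beta> + \<gamma>) \<delta> = form \<beta> \<delta> + form \<gamma> \<delta>"
  by (simp add: form_def algebra_simps sum.distrib)

lemma form_minus: "form (- \<beta>) \<delta> = - form \<beta> \<delta>"
  by (simp add: form_def sum_negf)

lemma form_scale: "form (\<lambda>j. c * \<beta> j) \<delta> = c * form \<beta> \<delta>"
  by (simp add: form_def sum_distrib_left mult.assoc)

lemma reflect_add: "reflect i (\<beta> + \<gamma>) = reflect i \<beta> + reflect i \<gamma>"
  by (simp add: reflect_def form_add fun_eq_iff algebra_simps)

lemma reflect_minus: "reflect i (- \<beta>) = - reflect i \<beta>"
  by (simp add: reflect_def form_minus fun_eq_iff)

lemma form_reflect:
  "i \<in> I \<Longrightarrow> j \<in> I \<Longrightarrow> form (reflect i \<beta>) (simple_root j)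
     = form \<beta> (simple_root j) - 2 * form \<beta> (simple_root i) * form_coeff i j"
proof -
  assume "i \<in> I" "j \<in> I"
  have "reflect i \<beta> = \<beta> + (\<lambda>k. (- 2 * form \<beta> (simple_root i)) * simple_root i k)"
    by (simp add: reflect_def fun_eq_iff)
  then show ?thesis
    using \<open>i \<in> I\<close> \<open>j \<in> I\<close> by (simp only: form_add form_scale form_simple_simple)
qed

lemma reflect_reflect: "i \<in> I \<Longrightarrow> reflect i (reflect i \<beta>) = \<beta>"
  unfolding reflect_def[of i "reflect i \<beta>"]
  by (simp add: form_reflect form_coeff_self) (simp add: reflect_def)

lemma reflect_commute:
  assumes "i \<in> I" "j \<in> I" "m i j = 2"
  shows "reflect i (reflect j \<beta>) = reflect j (reflect i \<beta>)"
proof -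
  have "m j i = 2" using assms m_sym by metis
  then show ?thesis
    unfolding reflect_def[of i "reflect j \<beta>"] reflect_def[of j "reflect i \<beta>"]
    using assms by (simp add: form_reflect form_coeff_2) (simp add: reflect_def fun_eq_iff)
qed

section \<open>The action of the group on the root space\<close>

lemma foldr_reflect_relation:
  assumes "i \<in> I" "j \<in> I"
  shows "foldr reflect (concat (replicate (m i j) [i, j])) \<beta> = \<beta>"
proof (cases "i = j")
  case True
  then show ?thesis using assms by (simp add: m_self reflect_reflect)
next
  case False
  from assms False show ?thesis
  proof (cases rule: m_cases)
    case 1
    then show ?thesis
      using assms by (simp add: numeral_2_eq_2 reflect_commute[of i j] reflect_reflect)
  next
    case 2
    then show ?thesis by simp
  qed
qed

lemma foldr_reflect_rev:
  "ws \<in> lists I \<Longrightarrow> foldr reflect (rev ws) (foldr reflect ws \<beta>) = \<beta>"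
  by (induction ws arbitrary: \<beta>) (auto simp: reflect_reflect)

lemma foldr_reflect_equiv:
  assumes "equivclp (coxeter_step I m) us vs"
  shows "foldr reflect us = foldr reflect vs"
  using assms
proof (induction rule: equivclp_induct)
  case (step y z)
  have *: "foldr reflect a = foldr reflect b" if "coxeter_step I m a b" for a b
    using that by cases (simp add: fun_eq_iff foldr_reflect_relation)
  show ?case using step * by metis
qed simp

text \<open>The word \<open>rev us @ vs\<close> evaluates to \<open>\<one>\<close>, so the
  presentation joins it to the empty word by defining relations, each of which acts trivially. Since
  \<open>rev us\<close> undoes \<open>us\<close>, both words act alike. This makes the choice of a
  word in \<open>act\<close> harmless.\<close>

lemma foldr_reflect_cong:
  assumes us: "us \<in> lists I" and vs: "vs \<in> lists I" and eq: "eval_word us = eval_word vs"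
  shows "foldr reflect us = foldr reflect vs"
proof
  fix \<beta>
  have "rev us @ vs \<in> lists I" using us vs by auto
  moreover have "eval_word (rev us @ vs) = \<one>"
    using us vs eq by (simp add: eval_word_append eval_word_rev)
  ultimately have "equivclp (coxeter_step I m) (rev us @ vs) []"
    using presentation[of "rev us @ vs"] unfolding eval_word_def m_def[abs_def] by blast
  then have "foldr reflect (rev us @ vs) \<beta> = \<beta>"
    by (simp only: foldr_reflect_equiv) simp
  then have "foldr reflect us \<beta> = foldr reflect us (foldr reflect (rev us) (foldr reflect vs \<beta>))"
    by simp
  also have "\<dots> = foldr reflect vs \<beta>"
    using foldr_reflect_rev[of "rev us"] us by simp
  finally show "foldr reflect us \<beta> = foldr reflect vs \<beta>" .
qed

lemma act_eval_word:
  assumes "ws \<in> lists I"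
  shows "act (eval_word ws) = foldr reflect ws"
proof -
  have "\<exists>vs. vs \<in> lists I \<and> eval_word vs = eval_word ws" using assms by blast
  from someI_ex[OF this] show ?thesis
    unfolding act_def using assms by (intro foldr_reflect_cong) auto
qed

lemma act_one [simp]: "act \<one> \<beta> = \<beta>"
  using act_eval_word[of "[]"] by simp

lemma act_gen: "i \<in> I \<Longrightarrow> act (s i) = reflect i"
  using act_eval_word[of "[i]"] by (simp add: gen_closed fun_eq_iff)

lemma act_mult:
  assumes "v \<in> carrier W" "w \<in> carrier W"
  shows "act (v \<otimes> w) \<beta> = act v (act w \<beta>)"
proof -
  obtain us where us: "us \<in> lists I" "eval_word us = v" using assms ex_word by blast
  obtain ws where ws: "ws \<in> lists I" "eval_word ws = w" using assms ex_word by blast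
  have "act (v \<otimes> w) = foldr reflect (us @ ws)"
    using us ws act_eval_word[of "us @ ws"] by (simp add: eval_word_append)
  moreover have "act v = foldr reflect us" "act w = foldr reflect ws"
    using us ws act_eval_word by blast+
  ultimately show ?thesis by simp
qed

lemma act_inv_cancel: "w \<in> carrier W \<Longrightarrow> act (inv w) (act w \<beta>) = \<beta>"
  by (simp flip: act_mult)

lemma act_cancel_inv: "w \<in> carrier W \<Longrightarrow> act w (act (inv w) \<beta>) = \<beta>"
  by (simp flip: act_mult)

lemma act_add:
  assumes "w \<in> carrier W"
  shows "act w (\<beta> + \<gamma>) = act w \<beta> + act w \<gamma>"
proof -
  obtain ws where ws: "ws \<in> lists I" "eval_word ws = w" using assms ex_word by blast
  have "foldr reflect ws (\<beta> + \<gamma>) = foldr reflect ws \<beta> + foldr reflect ws \<gamma>"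
    by (induction ws) (simp_all only: foldr.simps o_apply id_apply reflect_add)
  then show ?thesis using ws act_eval_word by metis
qed

lemma act_minus:
  assumes "w \<in> carrier W"
  shows "act w (- \<beta>) = - act w \<beta>"
proof -
  obtain ws where ws: "ws \<in> lists I" "eval_word ws = w" using assms ex_word by blast
  have "foldr reflect ws (- \<beta>) = - foldr reflect ws \<beta>"
    by (induction ws) (simp_all only: foldr.simps o_apply id_apply reflect_minus)
  then show ?thesis using ws act_eval_word by metis
qed

lemma act_diff: "w \<in> carrier W \<Longrightarrow> act w (\<beta> - \<gamma>) = act w \<beta> - act w \<gamma>"
  using act_add[of w \<beta> "- \<gamma>"] act_minus[of w \<gamma>] by simp

lemma act_inv_simple_root:
  assumes "u \<in> carrier W" "act u \<beta> = - simple_root j"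
  shows "act (inv u) (simple_root j) = - \<beta>"
proof -
  have "\<beta> = - act (inv u) (simple_root j)"
    using act_inv_cancel[OF assms(1), of \<beta>] assms(1) unfolding assms(2)
    by (simp only: act_minus inv_closed)
  then show ?thesis by simp
qed

text \<open>Vectors are functions on the whole index type. Knowing that roots vanish outside
  \<open>I\<close> lets equality of roots be decided by coordinates in \<open>I\<close>, as
  \<open>reflect_positive\<close> requires.\<close>

lemma act_vanishes:
  assumes "w \<in> carrier W" "\<And>j. j \<notin> I \<Longrightarrow> \<beta> j = 0" "j \<notin> I"
  shows "act w \<beta> j = 0"
proof -
  obtain ws where ws: "ws \<in> lists I" "eval_word ws = w" using assms ex_word by blast
  have "foldr reflect ws \<beta> j = 0"
    using ws(1) assms(2,3) by (induction ws) (auto simp: reflect_def simple_root_def)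
  then show ?thesis using ws act_eval_word by metis
qed

section \<open>Images of simple roots, length and ascents\<close>

lemma reflect_other: "j \<noteq> i \<Longrightarrow> reflect i \<beta> j = \<beta> j"
  by (simp add: reflect_def simple_root_def)

lemma reflect_simple_self: "i \<in> I \<Longrightarrow> reflect i (simple_root i) = - simple_root i"
  by (simp add: reflect_def form_simple_simple form_coeff_self fun_eq_iff)

lemma reflect_simple_2:
  "i \<in> I \<Longrightarrow> j \<in> I \<Longrightarrow> m i j = 2 \<Longrightarrow> reflect i (simple_root j) = simple_root j"
  using m_sym[of i j] by (simp add: reflect_def form_simple_simple form_coeff_2)

lemma reflect_simple_0:
  "i \<in> I \<Longrightarrow> j \<in> I \<Longrightarrow> m i j = 0 \<Longrightarrow>
     reflect i (simple_root j) = simple_root j + simple_root i + simple_root i"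
  using m_sym[of i j] by (simp add: reflect_def form_simple_simple form_coeff_0 fun_eq_iff)

text \<open>Here \<open>s\<^sub>j \<alpha>\<^sub>i = \<alpha>\<^sub>i + 2 \<alpha>\<^sub>j\<close>.
  Splitting it as \<open>(\<alpha>\<^sub>i + \<alpha>\<^sub>j) + \<alpha>\<^sub>j\<close> separates
  a vector that every group element keeps nonnegative from a simple root to which induction on
  length applies.\<close>

lemma act_mult_gen_0:
  assumes "v \<in> carrier W" "i \<in> I" "j \<in> I" "m i j = 0"
  shows "act (v \<otimes> s j) (simple_root i)
    = act v (simple_root i + simple_root j) + act v (simple_root j)"
proof -
  have "act (v \<otimes> s j) (simple_root i) = act v (reflect j (simple_root i))"
    using assms by (simp add: act_mult gen_closed act_gen)
  also have "\<dots> = act v (simple_root i + simple_root j + simple_root j)"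
    using assms m_sym[of i j] by (simp only: reflect_simple_0)
  finally show ?thesis
    using assms(1) by (simp only: act_add)
qed

text \<open>The Coxeter length. That \<open>w\<close> and \<open>w \<otimes> s i\<close> have
  different lengths is not established, so an ascent is expressed below as the negation
  \<open>\<not> len (w \<otimes> s i) < len w\<close> of a descent.\<close>

definition len :: "'a \<Rightarrow> nat" where
  "len w = (LEAST n. \<exists>ws \<in> lists I. length ws = n \<and> eval_word ws = w)"

lemma len_eval_word: "ws \<in> lists I \<Longrightarrow> len (eval_word ws) \<le> length ws"
  unfolding len_def by (rule Least_le) blast

lemma ex_reduced_word:
  assumes "w \<in> carrier W"
  obtains ws where "ws \<in> lists I" "eval_word ws = w" "length ws = len w"
proof -
  have "\<exists>n. \<exists>ws \<in> lists I. length ws = n \<and> eval_word ws = w"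
    using ex_word[OF assms] by blast
  from LeastI_ex[OF this] show ?thesis
    using that unfolding len_def by blast
qed

lemma len_mult_gen:
  assumes "w \<in> carrier W" "i \<in> I"
  shows "len (w \<otimes> s i) \<le> Suc (len w)"
proof -
  obtain ws where "ws \<in> lists I" "eval_word ws = w" "length ws = len w"
    using assms ex_reduced_word by blast
  then show ?thesis
    using len_eval_word[of "ws @ [i]"] assms by (simp add: eval_word_append gen_closed)
qed

lemma ex_descent:
  assumes "w \<in> carrier W" "w \<noteq> \<one>"
  obtains i v where "i \<in> I" "v \<in> carrier W" "w = v \<otimes> s i" "len v < len w"
proof -
  obtain ws where ws: "ws \<in> lists I" "eval_word ws = w" "length ws = len w"
    using assms ex_reduced_word by blast
  with assms(2) have "ws \<noteq> []" by auto
  then obtain vs i where vs: "ws = vs @ [i]" by (metis rev_exhaust)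
  show ?thesis
    using that[of i "eval_word vs"] ws vs len_eval_word[of vs]
    by (auto simp: eval_word_append gen_closed)
qed

lemma mult_gen_cancel: "w \<in> carrier W \<Longrightarrow> i \<in> I \<Longrightarrow> w \<otimes> s i \<otimes> s i = w"
  by (simp add: m_assoc gen_closed gen_square)

text \<open>If \<open>v \<otimes> s i\<close> were shorter than \<open>v\<close>, then \<open>v
  \<otimes> s j \<otimes> s i = v \<otimes> s i \<otimes> s j\<close> would have length at most
  \<open>len v\<close>, hence less than \<open>len (v \<otimes> s j)\<close>. This hands the ascent
  at \<open>i\<close> down to the shorter element in inductions that strip a last letter
  \<open>j\<close> commuting with \<open>i\<close>.\<close>

lemma len_descend_commute:
  assumes v: "v \<in> carrier W" and ij: "i \<in> I" "j \<in> I" "m i j = 2"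
    and less: "len v < len (v \<otimes> s j)" and asc: "\<not> len (v \<otimes> s j \<otimes> s i) < len (v \<otimes> s j)"
  shows "\<not> len (v \<otimes> s i) < len v"
proof
  assume "len (v \<otimes> s i) < len v"
  moreover have "v \<otimes> s j \<otimes> s i = v \<otimes> s i \<otimes> s j"
    using v ij by (simp add: m_assoc gen_closed gen_commute[of i j])
  ultimately show False
    using len_mult_gen[of "v \<otimes> s i" j] v ij less asc by (simp add: gen_closed)
qed

text \<open>The vectors \<open>\<alpha>\<^sub>i + \<alpha>\<^sub>j\<close> with \<open>m i j = 0\<close> are fixed by \<open>s\<^sub>i\<close> and \<open>s\<^sub>j\<close>, so in
  the induction they may be moved to the shortest element of the coset of \<open>\<langle>s\<^sub>i, s\<^sub>j\<rangle>\<close>.\<close>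

lemma act_nonneg_aux:
  assumes "w \<in> carrier W"
  shows "(\<forall>i\<in>I. \<not> len (w \<otimes> s i) < len w \<longrightarrow> nonneg (act w (simple_root i))) \<and>
    (\<forall>i\<in>I. \<forall>j\<in>I. m i j = 0 \<longrightarrow> nonneg (act w (simple_root i + simple_root j)))"
  using assms
proof (induction "len w" arbitrary: w rule: less_induct)
  case less
  have IH1: "nonneg (act v (simple_root i))"
    if "len v < len w" "v \<in> carrier W" "i \<in> I" "\<not> len (v \<otimes> s i) < len v" for v i
    using less.hyps that by blast
  have IH2: "nonneg (act v (simple_root i + simple_root j))"
    if "len v < len w" "v \<in> carrier W" "i \<in> I" "j \<in> I" "m i j = 0" for v i j
    using less.hyps that by blast
  have 1: "nonneg (act w (simple_root i))" if i: "i \<in> I" "\<not> len (w \<otimes> s i) < len w" for i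
  proof (cases "w = \<one>")
    case True
    then show ?thesis by (simp add: simple_root_def)
  next
    case False
    then obtain j v where v: "j \<in> I" "v \<in> carrier W" "w = v \<otimes> s j" "len v < len w"
      using ex_descent less.prems by metis
    have "i \<noteq> j" using v i by (auto simp: mult_gen_cancel)
    with i(1) v(1) show ?thesis
    proof (cases rule: m_cases)
      case 1
      then show ?thesis
        using IH1[of v i] len_descend_commute[of v i j] v i m_sym[of i j]
        by (simp add: act_mult gen_closed act_gen reflect_simple_2)
    next
      case 2
      have "act w (simple_root i) = act v (simple_root i + simple_root j) + act v (simple_root j)"
        using v i 2 by (simp only: act_mult_gen_0)
      \<comment> \<open>The index \<open>j\<close> is an ascent of \<open>v\<close>, because
        \<open>v \<otimes> s j = w\<close> is longer than \<open>v\<close>.\<close>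
      moreover have "nonneg (act v (simple_root j))"
        using IH1[of v j] v by simp
      ultimately show ?thesis
        using IH2[of v i j] v i 2 by auto
    qed
  qed
  have 2: "nonneg (act w (simple_root i + simple_root j))" if ij: "i \<in> I" "j \<in> I" "m i j = 0" for i j
  proof -
    have fixed: "act w (simple_root k + simple_root l) = act (w \<otimes> s k) (simple_root k + simple_root l)"
      if "k \<in> I" "l \<in> I" "m k l = 0" for k l
    proof -
      have "reflect k (simple_root k + simple_root l) = simple_root k + simple_root l"
        using that by (simp add: reflect_add reflect_simple_self reflect_simple_0 algebra_simps)
      then show ?thesis using that less.prems by (simp add: act_mult gen_closed act_gen)
    qed
    consider "len (w \<otimes> s i) < len w" | "len (w \<otimes> s j) < len w"
      | "\<not> len (w \<otimes> s i) < len w" "\<not> len (w \<otimes> s j) < len w" by blast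
    then show ?thesis
    proof cases
      case 1
      then show ?thesis
        using IH2[of "w \<otimes> s i" i j] fixed[of i j] ij less.prems by (simp add: gen_closed)
    next
      case 2
      then show ?thesis
        using IH2[of "w \<otimes> s j" j i] fixed[of j i] ij less.prems m_sym[of i j]
        by (simp add: gen_closed add.commute)
    next
      \<comment> \<open>Neither \<open>i\<close> nor \<open>j\<close> is a descent, so the first
        claim, just proved for this same \<open>w\<close>, applies to both summands.\<close>
      case 3
      then show ?thesis
        using 1[of i] 1[of j] ij less.prems by (simp add: act_add)
    qed
  qed
  show ?case using 1 2 by blast
qed

section \<open>The stable cone\<close>

definition stable_cone :: "('i \<Rightarrow> real) set" where
  "stable_cone = {v. \<forall>w\<in>carrier W. nonneg (act w v)}"

lemma stable_cone_nonneg: "v \<in> stable_cone \<Longrightarrow> w \<in> carrier W \<Longrightarrow> nonneg (act w v)"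
  by (simp add: stable_cone_def)

lemma zero_stable_cone: "0 \<in> stable_cone"
proof -
  have "act w 0 = 0" if "w \<in> carrier W" for w
    using act_add[OF that, of 0 0] by simp
  then show ?thesis by (simp add: stable_cone_def)
qed

lemma add_stable_cone: "u \<in> stable_cone \<Longrightarrow> v \<in> stable_cone \<Longrightarrow> u + v \<in> stable_cone"
  by (auto simp: stable_cone_def act_add)

lemma act_stable_cone: "v \<in> stable_cone \<Longrightarrow> w \<in> carrier W \<Longrightarrow> act w v \<in> stable_cone"
  by (auto simp: stable_cone_def simp flip: act_mult)

lemma simple_sum_stable_cone:
  "i \<in> I \<Longrightarrow> j \<in> I \<Longrightarrow> m i j = 0 \<Longrightarrow> simple_root i + simple_root j \<in> stable_cone"
  using act_nonneg_aux by (simp add: stable_cone_def)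

text \<open>Strip a last letter \<open>k\<close> from \<open>w = v \<otimes> s k\<close>. If
  \<open>k\<close> commutes with \<open>j\<close>, then \<open>w\<close> and \<open>v\<close> agree
  on \<open>\<alpha>\<^sub>j\<close> and \<open>j\<close> remains an ascent of \<open>v\<close>.
  Otherwise \<open>w \<alpha>\<^sub>j\<close> is \<open>v \<alpha>\<^sub>k\<close> plus a vector of
  the cone, and \<open>k\<close> is an ascent of \<open>v\<close>. The simple root found at the end
  need not be \<open>\<alpha>\<^sub>j\<close>.\<close>

lemma ascent_stable_cone:
  assumes "w \<in> carrier W" "j \<in> I" "\<not> len (w \<otimes> s j) < len w"
  shows "\<exists>i\<in>I. act w (simple_root j) - simple_root i \<in> stable_cone"
  using assms
proof (induction "len w" arbitrary: w j rule: less_induct)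
  case less
  show ?case
  proof (cases "w = \<one>")
    case True
    then show ?thesis
      using less.prems zero_stable_cone by (intro bexI[of _ j]) simp_all
  next
    case False
    then obtain k v where v: "k \<in> I" "v \<in> carrier W" "w = v \<otimes> s k" "len v < len w"
      using ex_descent less.prems by metis
    have "j \<noteq> k" using v less.prems by (auto simp: mult_gen_cancel)
    with less.prems(2) v(1) show ?thesis
    proof (cases rule: m_cases)
      case 1
      then show ?thesis
        using less.hyps[of v j] len_descend_commute[of v j k] v less.prems m_sym[of j k]
        by (simp add: act_mult gen_closed act_gen reflect_simple_2)
    next
      case 2
      have "act w (simple_root j) = act v (simple_root j + simple_root k) + act v (simple_root k)"
        using v less.prems 2 by (simp only: act_mult_gen_0)
      moreover have "act v (simple_root j + simple_root k) \<in> stable_cone"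
        using v less.prems 2 by (simp add: act_stable_cone simple_sum_stable_cone)
      moreover obtain i where "i \<in> I" "act v (simple_root k) - simple_root i \<in> stable_cone"
        using less.hyps[of v k] v by auto
      ultimately show ?thesis
        using add_stable_cone by (metis add_diff_eq)
    qed
  qed
qed

section \<open>Positive and negative roots\<close>

lemma act_root: "w \<in> carrier W \<Longrightarrow> \<beta> \<in> roots \<Longrightarrow> act w \<beta> \<in> roots"
  unfolding roots_def using act_mult m_closed by (smt (verit) mem_Collect_eq)

lemma simple_root_root: "i \<in> I \<Longrightarrow> simple_root i \<in> roots"
  unfolding roots_def by (metis (mono_tags, lifting) act_one mem_Collect_eq one_closed)

lemma simple_root_positive: "i \<in> I \<Longrightarrow> simple_root i \<in> positive_roots"
  by (simp add: positive_roots_def simple_root_root) (simp add: simple_root_def)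

lemma minus_root:
  assumes "\<beta> \<in> roots"
  shows "- \<beta> \<in> roots"
proof -
  obtain w i where w: "w \<in> carrier W" "i \<in> I" "\<beta> = act w (simple_root i)"
    using assms unfolding roots_def by auto
  then have "- \<beta> = act (w \<otimes> s i) (simple_root i)"
    by (simp add: act_mult gen_closed act_gen reflect_simple_self act_minus)
  then show ?thesis
    using w gen_closed unfolding roots_def by blast
qed

lemma root_vanishes: "\<beta> \<in> roots \<Longrightarrow> j \<notin> I \<Longrightarrow> \<beta> j = 0"
  unfolding roots_def by (auto intro!: act_vanishes simp: simple_root_def)

text \<open>Write the root as \<open>w \<alpha>\<^sub>j\<close>. If \<open>j\<close> is a descent of
  \<open>w\<close>, it is an ascent of \<open>w \<otimes> s j\<close>, which sends
  \<open>\<alpha>\<^sub>j\<close> to the negative of the root; so \<open>ascent_stable_cone\<close>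
  covers both cases.\<close>

lemma root_stable_cone:
  assumes "\<beta> \<in> roots"
  shows "\<exists>i\<in>I. \<beta> - simple_root i \<in> stable_cone \<or> - \<beta> - simple_root i \<in> stable_cone"
proof -
  obtain w j where w: "w \<in> carrier W" "j \<in> I" "\<beta> = act w (simple_root j)"
    using assms unfolding roots_def by auto
  show ?thesis
  proof (cases "len (w \<otimes> s j) < len w")
    case False
    then show ?thesis using ascent_stable_cone w by blast
  next
    case True
    moreover have "- \<beta> = act (w \<otimes> s j) (simple_root j)"
      using w by (simp add: act_mult gen_closed act_gen reflect_simple_self act_minus)
    ultimately show ?thesis
      using ascent_stable_cone[of "w \<otimes> s j" j] w by (auto simp: gen_closed mult_gen_cancel)
  qed
qed

lemma nonneg_of_stable_cone:
  assumes "\<beta> - simple_root i \<in> stable_cone" "i \<in> I"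
  shows "nonneg \<beta>" "1 \<le> \<beta> i"
proof -
  have *: "0 \<le> \<beta> j - simple_root i j" if "j \<in> I" for j
    using stable_cone_nonneg[OF assms(1) one_closed] that by simp
  show "1 \<le> \<beta> i" using *[of i] assms(2) by (simp add: simple_root_def)
  show "nonneg \<beta>"
  proof
    fix j assume "j \<in> I"
    with *[of j] show "0 \<le> \<beta> j" by (simp add: simple_root_def split: if_splits)
  qed
qed

lemma positive_or_negative: "\<beta> \<in> roots \<Longrightarrow> \<beta> \<in> positive_roots \<or> - \<beta> \<in> positive_roots"
  using root_stable_cone[of \<beta>] nonneg_of_stable_cone(1) minus_root
  unfolding positive_roots_def by blast

lemma positive_stable_cone:
  assumes "\<beta> \<in> positive_roots"
  obtains i where "i \<in> I" "\<beta> - simple_root i \<in> stable_cone"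
proof -
  have False if "i \<in> I" "- \<beta> - simple_root i \<in> stable_cone" for i
    using nonneg_of_stable_cone(2)[OF that(2,1)] assms that(1) unfolding positive_roots_def by force
  then show ?thesis
    using root_stable_cone[of \<beta>] assms that unfolding positive_roots_def by blast
qed

lemma not_positive_and_negative:
  assumes "\<beta> \<in> positive_roots" "- \<beta> \<in> positive_roots"
  shows False
proof -
  obtain i where "i \<in> I" "\<beta> - simple_root i \<in> stable_cone"
    using assms(1) by (rule positive_stable_cone)
  then have "1 \<le> \<beta> i" by (simp add: nonneg_of_stable_cone(2))
  moreover have "0 \<le> - \<beta> i"
    using assms(2) \<open>i \<in> I\<close> unfolding positive_roots_def by auto
  ultimately show False by simp
qed

text \<open>A reflection \<open>s\<^sub>i\<close> changes only coordinate \<open>i\<close>. If it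
  made \<open>\<beta>\<close> negative, all other coordinates of \<open>\<beta>\<close> would
  vanish, so \<open>\<beta>\<close> would be a multiple of \<open>\<alpha>\<^sub>i\<close>. The
  stable cone then forces the factor to be 1, without using invariance of the form.\<close>

lemma reflect_positive:
  assumes i: "i \<in> I" and \<beta>: "\<beta> \<in> positive_roots" and ne: "\<beta> \<noteq> simple_root i"
  shows "reflect i \<beta> \<in> positive_roots"
proof (rule ccontr)
  assume np: "reflect i \<beta> \<notin> positive_roots"
  have root: "\<beta> \<in> roots" using \<beta> unfolding positive_roots_def by simp
  have "reflect i \<beta> \<in> roots"
    using act_root[OF gen_closed[OF i] root] i by (simp add: act_gen)
  then have neg: "- reflect i \<beta> \<in> positive_roots"
    using np positive_or_negative by blast
  have zero: "\<beta> j = 0" if "j \<noteq> i" for j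
  proof (cases "j \<in> I")
    case True
    have "0 \<le> \<beta> j" using \<beta> True unfolding positive_roots_def by simp
    moreover have "0 \<le> - \<beta> j"
      using neg True that reflect_other[OF that, of \<beta>] unfolding positive_roots_def by force
    ultimately show ?thesis by simp
  next
    case False
    then show ?thesis using root root_vanishes by blast
  qed
  obtain k where k: "k \<in> I" "\<beta> - simple_root k \<in> stable_cone"
    using \<beta> by (rule positive_stable_cone)
  then have "1 \<le> \<beta> k" by (simp add: nonneg_of_stable_cone(2))
  with zero have "k = i" by force
  \<comment> \<open>With \<open>c = \<beta> i\<close>, which is at least 1, the vector
    \<open>(c - 1) \<alpha>\<^sub>i\<close> lies in the stable cone. Its image
    \<open>- (c - 1) \<alpha>\<^sub>i\<close> under \<open>s\<^sub>i\<close> must be nonnegative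
    too, so \<open>c = 1\<close>.\<close>
  have "\<beta> - simple_root i = (\<lambda>j. (\<beta> i - 1) * simple_root i j)"
    using zero by (auto simp: fun_eq_iff simple_root_def)
  moreover have "reflect i (\<lambda>j. c * simple_root i j) = (\<lambda>j. - c * simple_root i j)" for c
    using i by (simp add: reflect_def form_scale form_simple_simple form_coeff_self fun_eq_iff)
  ultimately have "reflect i (\<beta> - simple_root i) i = - (\<beta> i - 1)"
    by (simp add: simple_root_def)
  moreover have "0 \<le> reflect i (\<beta> - simple_root i) i"
    using stable_cone_nonneg[OF k(2) gen_closed[OF i]] \<open>k = i\<close> i by (simp add: act_gen)
  ultimately have "\<beta> i = 1" using \<open>1 \<le> \<beta> k\<close> \<open>k = i\<close> by simp
  then have "\<beta> = simple_root i"
    using zero by (auto simp: fun_eq_iff simple_root_def)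
  with ne show False by simp
qed

section \<open>Toggles, separating roots and promotion\<close>

lemma toggle_closed: "i \<in> I \<Longrightarrow> u \<in> carrier W \<Longrightarrow> toggle L i u \<in> carrier W"
  by (simp add: toggle_def gen_closed)

lemma fold_toggle_closed:
  "set xs \<subseteq> I \<Longrightarrow> u \<in> carrier W \<Longrightarrow> fold (toggle L) xs u \<in> carrier W"
  by (induction xs arbitrary: u) (auto simp: toggle_closed)

text \<open>By \<open>reflect_positive\<close>, going from \<open>u\<close> to
  \<open>s i \<otimes> u\<close> can leave the half-space of \<open>\<beta>\<close> only if
  \<open>u \<beta> = \<alpha>\<^sub>i\<close>. Then
  \<open>u\<inverse> \<alpha>\<^sub>i = \<beta>\<close> belongs to
  \<open>containing_roots L\<close>, and the toggle does not move \<open>u\<close>.\<close>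

lemma toggle_half_space:
  assumes i: "i \<in> I" and \<beta>: "\<beta> \<in> containing_roots L" and u: "u \<in> half_space \<beta>"
  shows "toggle L i u \<in> half_space \<beta>"
proof (cases "act (inv u) (simple_root i) \<in> containing_roots L")
  case True
  then show ?thesis using u by (simp add: toggle_def)
next
  case False
  have uc: "u \<in> carrier W" and pos: "act u \<beta> \<in> positive_roots"
    using u by (auto simp: half_space_def)
  have "act u \<beta> \<noteq> simple_root i"
    using False \<beta> uc act_inv_cancel by metis
  then have "reflect i (act u \<beta>) \<in> positive_roots"
    using i pos by (rule reflect_positive[rotated 2])
  then show ?thesis
    using False i uc by (simp add: toggle_def half_space_def gen_closed act_mult act_gen)
qed

lemma fold_toggle_half_space:
  assumes "set xs \<subseteq> I" "\<beta> \<in> containing_roots L" "u \<in> half_space \<beta>"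
  shows "fold (toggle L) xs u \<in> half_space \<beta>"
  using assms by (induction xs arbitrary: u) (auto simp: toggle_half_space)

lemma ex_adjacent_separating_root:
  assumes L: "convex_subset L" and u: "u \<in> carrier W" "u \<notin> L"
  obtains \<beta> j where "\<beta> \<in> containing_roots L" "j \<in> I" "act u \<beta> = - simple_root j"
proof -
  obtain A where A: "A \<subseteq> roots" "L = carrier W \<inter> (\<Inter>\<beta>\<in>A. half_space \<beta>)"
    using L unfolding convex_subset_def by blast
  then obtain \<gamma> where \<gamma>: "\<gamma> \<in> A" "u \<notin> half_space \<gamma>" using u by blast
  then have root: "\<gamma> \<in> roots" using A by blast
  have "- act u \<gamma> \<in> positive_roots"
    using \<gamma> u act_root[OF u(1) root] positive_or_negative by (auto simp: half_space_def)
  then obtain j where j: "j \<in> I" and cone: "- act u \<gamma> - simple_root j \<in> stable_cone"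
    by (rule positive_stable_cone)
  \<comment> \<open>This is the root that \<open>u\<close> sends to
    \<open>- \<alpha>\<^sub>j\<close>, where \<open>\<alpha>\<^sub>j\<close> is a simple root that
    can be split off from \<open>- u \<gamma>\<close> inside the stable cone.\<close>
  define \<beta> where "\<beta> = - act (inv u) (simple_root j)"
  have "\<beta> \<in> roots"
    using j u by (simp add: \<beta>_def minus_root act_root simple_root_root)
  moreover have "x \<in> half_space \<beta>" if "x \<in> L" for x
  proof -
    have x: "x \<in> carrier W" "nonneg (act x \<gamma>)"
      using that A \<gamma> by (auto simp: half_space_def positive_roots_def)
    \<comment> \<open>Moving the cone vector by \<open>x \<otimes> inv u\<close> shows that
      \<open>x \<beta>\<close> dominates \<open>x \<gamma>\<close> coordinatewise. Since
      \<open>x\<close> lies in \<open>L\<close>, the latter is nonnegative.\<close>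
    have "act (x \<otimes> inv u) (- act u \<gamma> - simple_root j) = act x \<beta> - act x \<gamma>"
      using x u by (simp add: act_mult act_diff act_minus act_inv_cancel \<beta>_def)
    with stable_cone_nonneg[OF cone, of "x \<otimes> inv u"] x u
    have "0 \<le> act x \<beta> i - act x \<gamma> i" if "i \<in> I" for i
      using that by simp
    with x(2) have "nonneg (act x \<beta>)" by fastforce
    then show ?thesis
      using x \<open>\<beta> \<in> roots\<close> act_root by (simp add: half_space_def positive_roots_def)
  qed
  ultimately have "\<beta> \<in> containing_roots L" by (auto simp: containing_roots_def)
  moreover have "act u \<beta> = - simple_root j"
    using u by (simp add: \<beta>_def act_minus act_cancel_inv)
  ultimately show ?thesis using that j by blast
qed

lemma toggle_adjacent:
  assumes \<beta>: "\<beta> \<in> containing_roots L" and j: "j \<in> I" and u: "u \<in> carrier W"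
    and adj: "act u \<beta> = - simple_root j" and i: "i \<in> I" "i \<noteq> j"
  shows "act (toggle L i u) \<beta> = - simple_root j"
proof (cases "act (inv u) (simple_root i) \<in> containing_roots L")
  case True
  then show ?thesis using adj by (simp add: toggle_def)
next
  case False
  have "m i j \<noteq> 0"
  proof
    assume m: "m i j = 0"
    have \<beta>_eq: "\<beta> = - act (inv u) (simple_root j)"
      using act_inv_simple_root[OF u adj] by simp
    have "x \<in> half_space (act (inv u) (simple_root i))" if "x \<in> L" for x
    proof -
      have x: "x \<in> carrier W" "nonneg (act x \<beta>)"
        using that \<beta> by (auto simp: containing_roots_def half_space_def positive_roots_def)
      \<comment> \<open>Since \<open>\<alpha>\<^sub>i + \<alpha>\<^sub>j\<close> is in the stable
        cone, \<open>x u\<inverse> \<alpha>\<^sub>i\<close> dominates \<open>x \<beta>\<close>,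
        which is nonnegative on \<open>L\<close>. Hence \<open>u\<inverse> \<alpha>\<^sub>i\<close>
        is in \<open>containing_roots L\<close>, contrary to the case assumption.\<close>
      have "act (x \<otimes> inv u) (simple_root i + simple_root j)
          = act x (act (inv u) (simple_root i)) - act x \<beta>"
        using x u by (simp add: act_mult act_add act_minus \<beta>_eq)
      with stable_cone_nonneg[OF simple_sum_stable_cone[OF i(1) j m], of "x \<otimes> inv u"] x u
      have "0 \<le> act x (act (inv u) (simple_root i)) k - act x \<beta> k" if "k \<in> I" for k
        using that by simp
      with x(2) have "nonneg (act x (act (inv u) (simple_root i)))" by fastforce
      then show ?thesis
        using x u i by (simp add: half_space_def positive_roots_def act_root simple_root_root)
    qed
    then have "act (inv u) (simple_root i) \<in> containing_roots L"
      using u i by (auto simp: containing_roots_def act_root simple_root_root)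
    with False show False by simp
  qed
  then have "m i j = 2" using i j by (auto elim: m_cases)
  then show ?thesis
    using False i j u adj
    by (simp add: toggle_def act_mult gen_closed act_gen reflect_minus reflect_simple_2)
qed

text \<open>Toggles before the first \<open>j\<close> keep
  \<open>u \<beta> = - \<alpha>\<^sub>j\<close>, the toggle at \<open>j\<close> turns this into
  \<open>\<alpha>\<^sub>j\<close>, and later toggles cannot leave the half-space of
  \<open>\<beta>\<close>.\<close>

lemma fold_toggle_crosses:
  assumes "L \<noteq> {}" "\<beta> \<in> containing_roots L" "j \<in> I" "u \<in> carrier W"
    "act u \<beta> = - simple_root j" "set xs \<subseteq> I" "j \<in> set xs"
  shows "fold (toggle L) xs u \<in> half_space \<beta>"
  using assms(4-)
proof (induction xs arbitrary: u)
  case (Cons i xs)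
  show ?case
  proof (cases "i = j")
    case False
    have i: "i \<in> I" using Cons.prems(3) by simp
    have "act (toggle L i u) \<beta> = - simple_root j"
      using assms(2,3) Cons.prems(1,2) i False by (rule toggle_adjacent)
    then have "fold (toggle L) xs (toggle L i u) \<in> half_space \<beta>"
      using Cons.IH toggle_closed[OF i] Cons.prems False by simp
    then show ?thesis by simp
  next
    case True
    obtain x where x: "x \<in> L" using assms(1) by blast
    have "act (inv u) (simple_root j) = - \<beta>"
      using Cons.prems(1,2) by (rule act_inv_simple_root)
    \<comment> \<open>Nonemptiness of \<open>L\<close> enters here: its point \<open>x\<close>
      cannot make both \<open>\<beta>\<close> and \<open>- \<beta>\<close> positive. Hence the
      toggle at \<open>j\<close> does move.\<close>
    moreover have "- \<beta> \<notin> containing_roots L"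
    proof
      assume "- \<beta> \<in> containing_roots L"
      then have "x \<in> half_space \<beta>" "x \<in> half_space (- \<beta>)"
        using x assms(2) by (auto simp: containing_roots_def)
      then show False
        using not_positive_and_negative by (auto simp: half_space_def act_minus)
    qed
    ultimately have "toggle L j u = s j \<otimes> u" by (simp add: toggle_def)
    moreover have "act (s j \<otimes> u) \<beta> = reflect j (- simple_root j)"
      using assms(3) Cons.prems(1) by (simp add: act_mult gen_closed act_gen flip: Cons.prems(2))
    then have "act (s j \<otimes> u) \<beta> = simple_root j"
      using assms(3) by (simp only: reflect_minus reflect_simple_self minus_minus)
    ultimately have "toggle L j u \<in> half_space \<beta>"
      using assms(3) Cons.prems(1) by (simp add: half_space_def gen_closed simple_root_positive)
    then show ?thesis
      using True Cons.prems fold_toggle_half_space[OF _ assms(2)] by simp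
  qed
qed simp

text \<open>Walk from \<open>x\<close> to \<open>u\<close> along a word for
  \<open>u \<otimes> inv x\<close>. By \<open>reflect_positive\<close>, a step from \<open>v\<close>
  to \<open>s i \<otimes> v\<close> makes at most one new root negative, namely
  \<open>v\<inverse> \<alpha>\<^sub>i\<close>.\<close>

lemma finite_separating:
  assumes "u \<in> carrier W" "x \<in> carrier W"
  shows "finite {\<beta> \<in> roots. x \<in> half_space \<beta> \<and> u \<notin> half_space \<beta>}"
proof -
  have *: "finite {\<beta> \<in> roots. x \<in> half_space \<beta> \<and> eval_word ws \<otimes> x \<notin> half_space \<beta>}"
    if "ws \<in> lists I" for ws
    using that
  proof (induction ws)
    case Nil
    show ?case using assms(2) by simp
  next
    case (Cons i ws)
    define v where "v = eval_word ws \<otimes> x"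
    have v: "v \<in> carrier W" "i \<in> I" "eval_word (i # ws) \<otimes> x = s i \<otimes> v"
      using Cons assms(2) by (simp_all add: v_def m_assoc gen_closed)
    have "\<beta> = act (inv v) (simple_root i)"
      if \<beta>: "v \<in> half_space \<beta>" "s i \<otimes> v \<notin> half_space \<beta>" for \<beta>
    proof -
      have "act v \<beta> = simple_root i"
        using \<beta> v(1,2) reflect_positive[of i "act v \<beta>"]
        by (auto simp: half_space_def gen_closed act_mult act_gen)
      then show ?thesis using act_inv_cancel[OF v(1), of \<beta>] by simp
    qed
    then have "{\<beta> \<in> roots. x \<in> half_space \<beta> \<and> s i \<otimes> v \<notin> half_space \<beta>} \<subseteq>
      insert (act (inv v) (simple_root i)) {\<beta> \<in> roots. x \<in> half_space \<beta> \<and> v \<notin> half_space \<beta>}"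
      by blast
    moreover have "finite {\<beta> \<in> roots. x \<in> half_space \<beta> \<and> v \<notin> half_space \<beta>}"
      using Cons.IH by (simp add: v_def)
    ultimately show ?case
      unfolding v(3) by (rule finite_subset[OF _ finite.insertI])
  qed
  have "u \<otimes> inv x \<in> carrier W" using assms by simp
  then obtain ws where ws: "ws \<in> lists I" "eval_word ws = u \<otimes> inv x"
    using ex_word by blast
  have "eval_word ws \<otimes> x = u" unfolding ws(2) using assms by (simp add: m_assoc)
  with *[OF ws(1)] show ?thesis by simp
qed

lemma promotion_reaches:
  assumes L: "convex_subset L" "L \<noteq> {}" and xs: "set xs = I" and u: "u \<in> carrier W"
  shows "\<exists>K. (promotion L xs ^^ K) u \<in> L"
proof -
  define sep where "sep v = {\<beta> \<in> containing_roots L. v \<notin> half_space \<beta>}" for v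
  obtain x where x: "x \<in> L" using L by blast
  then have xc: "x \<in> carrier W" using L unfolding convex_subset_def by blast
  \<comment> \<open>Every root of \<open>containing_roots L\<close> is positive at the chosen point
    \<open>x\<close> of \<open>L\<close>, so \<open>sep v\<close> consists of roots separating
    \<open>v\<close> from \<open>x\<close>.\<close>
  have fin: "finite (sep v)" if "v \<in> carrier W" for v
    using x by (intro finite_subset[OF _ finite_separating[OF that xc]])
      (auto simp: sep_def containing_roots_def)
  show ?thesis
    using u
  proof (induction "card (sep u)" arbitrary: u rule: less_induct)
    case less
    show ?case
    proof (cases "u \<in> L")
      case True
      then show ?thesis by (intro exI[of _ 0]) simp
    next
      case False
      obtain \<beta> j where \<beta>: "\<beta> \<in> containing_roots L" "j \<in> I" "act u \<beta> = - simple_root j"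
        using ex_adjacent_separating_root[OF L(1) less.prems False] by blast
      let ?v = "promotion L xs u"
      have v: "?v \<in> carrier W"
        using xs less.prems by (simp add: promotion_def fold_toggle_closed)
      \<comment> \<open>A promotion leaves no half-space containing \<open>L\<close> and enters that
        of \<open>\<beta>\<close>, so the set of separating roots loses \<open>\<beta>\<close> and
        gains nothing.\<close>
      have "sep ?v \<subseteq> sep u"
        using xs fold_toggle_half_space[of xs] by (auto simp: sep_def promotion_def)
      moreover have "\<beta> \<notin> sep ?v"
        using fold_toggle_crosses[OF L(2) \<beta>(1,2) less.prems \<beta>(3)] xs \<beta>(2)
        by (simp add: sep_def promotion_def)
      moreover have "\<beta> \<in> sep u"
      proof -
        have "u \<notin> half_space \<beta>"
          using \<beta> simple_root_positive not_positive_and_negative by (auto simp: half_space_def)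
        then show ?thesis using \<beta> by (simp add: sep_def)
      qed
      ultimately have "card (sep ?v) < card (sep u)"
        by (intro psubset_card_mono fin less.prems) blast
      with less.hyps v obtain K where "(promotion L xs ^^ K) ?v \<in> L" by blast
      then show ?thesis
        by (intro exI[of _ "Suc K"]) (simp only: funpow_Suc_right o_apply)
    qed
  qed
qed

end

theorem theorem1p16:
  fixes W :: "('a, 'b) monoid_scheme" and I :: "'i set" and s :: "'i \<Rightarrow> 'a"
  assumes "coxeter_system W I s"
    and "coxeter_system.right_angled W I s"
  shows "coxeter_system.superfuturistic W I s"
proof -
  interpret right_angled_coxeter_system W I s
    using assms by (simp add: right_angled_coxeter_system_def right_angled_coxeter_system_axioms_def)
  show ?thesis
    unfolding superfuturistic_def superheavy_def index_ordering_def
    by (simp add: promotion_reaches)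
qed

end
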